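(* Let $f_0,F:\mathbb{R}^n\times\mathbb{R}^d\to\mathbb{R}$ be twice continuously differentiable functions. For $w\in\mathbb{R}^d$ put $C(w)=\{x\in\mathbb{R}^n\mid F(x,w)\le 0\}$ and $$S(w)=\{x\in\mathbb{R}^n\mid 0\in\nabla_xf_0(x,w)+N_{C(w)}(x)\}.$$ Let $\bar w\in\mathbb{R}^d$ and $\bar x\in S(\bar w)$. Suppose that $F(\bar x,\bar w)=0$, that $\nabla_xF(\bar x,\bar w)\neq 0$, and that the unique $\lambda\ge 0$ with $\nabla_xf_0(\bar x,\bar w)+\lambda\nabla_xF(\bar x,\bar w)=0$ is zero. Put $$A'_1=\left[\nabla^2_{xx}f_0(\bar x,\bar w)\quad\nabla_xF(\bar x,\bar w)\right]\in\mathbb{R}^{n\times(n+1)},\qquad A'_2=\left[\nabla^2_{wx}f_0(\bar x,\bar w)\quad\nabla_wF(\bar x,\bar w)\right]\in\mathbb{R}^{d\times(n+1)}.$$ For $x'\in\mathbb{R}^n$ let $\widehat\Gamma_1(x')$ be the set of all $w'\in\mathbb{R}^d$ for which there exist $v'_1\in\mathbb{R}^n$ and $\gamma\in\mathbb{R}$ with $$(\ast)\quad w'=\nabla^2_{wx}f_0(\bar x,\bar w)v'_1+\gamma\nabla_wF(\bar x,\bar w),\qquad \nabla^2_{xx}f_0(\bar x,\bar w)v'_1+\gamma\nabla_xF(\bar x,\bar w)=-x',$$ $\nabla_xF(\bar x,\bar w)v'_1\ge 0$ and $\gamma\ge 0$. Let $\Gamma_3(x')$ be the set of all $w'\in\mathbb{R}^d$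 for which there exist $v'_1\in\mathbb{R}^n$ and $\gamma\in\mathbb{R}$ satisfying $(\ast)$ and one of the following: $\nabla_xF(\bar x,\bar w)v'_1=0$; or $\nabla_xF(\bar x,\bar w)v'_1>0$ and $\gamma\ge 0$; or $\nabla_xF(\bar x,\bar w)v'_1<0$ and $\gamma=0$. Then: (i) for every $x'\in\mathbb{R}^n$, $\widehat\Gamma_1(x')\subset\widehat D^*S(\bar w|\bar x)(x')\subset D^*S(\bar w|\bar x)(x')$; (ii) if $\ker A'_1\cap\ker A'_2=\{0\}$, then for every $x'\in\mathbb{R}^n$, $D^*S(\bar w|\bar x)(x')\subset\Gamma_3(x')$.
   Context: Fréchet normal cone: for $\Omega\subset\mathbb{R}^s$ and $\bar v\in\Omega$, $\widehat N_\Omega(\bar v)=\{v'\in\mathbb{R}^s\mid \limsup_{v\to\bar v,\,v\in\Omega}\frac{\langle v',v-\bar v\rangle}{\|v-\bar v\|}\le 0\}$, and $\widehat N_\Omega(\bar v)=\emptyset$ if $\bar v\notin\Omega$. Mordukhovich (limiting) normal cone, for $\Omega$ locally closed around $\bar v\in\Omega$: $N_\Omega(\bar v)$ is the set of all $v'$ for which there are sequences $v_k\to\bar v$, $v'_k\to v'$ with $v'_k\in\widehat N_\Omega(v_k)$ for all $k$; $N_\Omega(\bar v)=\emptyset$ if $\bar v\notin\Omega$. Coderivatives of $S:\mathbb{R}^d\rightrightarrows\mathbb{R}^n$ at $(\bar w,\bar x)\in\mathrm{gph}\,S=\{(w,x)\mid x\in S(w)\}$: the Fréchet coderivative is $\widehat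 D^*S(\bar w|\bar x)(x')=\{w'\in\mathbb{R}^d\mid(w',-x')\in\widehat N_{\mathrm{gph}\,S}(\bar w,\bar x)\}$ and the Mordukhovich coderivative is $D^*S(\bar w|\bar x)(x')=\{w'\in\mathbb{R}^d\mid(w',-x')\in N_{\mathrm{gph}\,S}(\bar w,\bar x)\}$, $x'\in\mathbb{R}^n$. $\nabla^2_{xx}f_0$ is the $n\times n$ Hessian in $x$ and $\nabla^2_{wx}f_0$ is the $d\times n$ matrix with entries $\partial^2f_0/\partial w_i\partial x_j$. Gradients $\nabla_xF(\bar x,\bar w)$ and $\nabla_wF(\bar x,\bar w)$ are column vectors in $A'_1,A'_2$, which act on pairs $(v'_1,\gamma)\in\mathbb{R}^n\times\mathbb{R}$; $\nabla_xF(\bar x,\bar w)v'_1$ means $\langle\nabla_xF(\bar x,\bar w),v'_1\rangle$. *)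

theory Defs
  imports "HOL-Analysis.Analysis"
begin

definition C2 :: "('a::real_normed_vector \<Rightarrow> real) \<Rightarrow> bool" where
  "C2 f \<longleftrightarrow> (\<exists>(f' :: 'a \<Rightarrow> 'a \<Rightarrow>\<^sub>L real) (f'' :: 'a \<Rightarrow> 'a \<Rightarrow>\<^sub>L 'a \<Rightarrow>\<^sub>L real).
      (\<forall>z. (f has_derivative blinfun_apply (f' z)) (at z)) \<and>
      (\<forall>z. (f' has_derivative blinfun_apply (f'' z)) (at z)) \<and>
      continuous_on UNIV f'')"

definition partial_deriv :: "(real^'m \<Rightarrow> real) \<Rightarrow> 'm::finite \<Rightarrow> real^'m \<Rightarrow> real" where
  "partial_deriv g i v = deriv (\<lambda>t. g (v + t *\<^sub>R axis i 1)) 0"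

definition grad_x :: "((real^'n) \<times> (real^'d) \<Rightarrow> real) \<Rightarrow> real^'n \<Rightarrow> real^'d \<Rightarrow> real^('n::finite)" where
  "grad_x f x w = (\<chi> i. partial_deriv (\<lambda>y. f (y, w)) i x)"

definition grad_w :: "((real^'n) \<times> (real^'d) \<Rightarrow> real) \<Rightarrow> real^'n \<Rightarrow> real^'d \<Rightarrow> real^('d::finite)" where
  "grad_w f x w = (\<chi> i. partial_deriv (\<lambda>u. f (x, u)) i w)"

definition hess_xx :: "((real^'n) \<times> (real^'d) \<Rightarrow> real) \<Rightarrow> real^'n \<Rightarrow> real^'d \<Rightarrow> real^('n::finite)^'n" where
  "hess_xx f x w = (\<chi> i j. partial_deriv (\<lambda>y. grad_x f y w $ j) i x)"

definition hess_wx :: "((real^'n) \<times> (real^'d) \<Rightarrow> real) \<Rightarrow> real^'n \<Rightarrow> real^'d \<Rightarrow> real^('n::finite)^('d::finite)" where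
  "hess_wx f x w = (\<chi> i j. partial_deriv (\<lambda>u. grad_x f x u $ j) i w)"

(* At an isolated point of Om the filter is trivial and the limsup is -\<infinity>, so every vector is a normal. *)
definition frechet_normal_cone :: "'a::real_inner set \<Rightarrow> 'a \<Rightarrow> 'a set" where
  "frechet_normal_cone Om v0 =
     (if v0 \<in> Om
      then {v'. Limsup (at v0 within Om) (\<lambda>v. ereal (inner v' (v - v0) / norm (v - v0))) \<le> 0}
      else {})"

(* Used only at points around which Om is locally closed; the formula itself does not need this. *)
definition normal_cone :: "'a::real_inner set \<Rightarrow> 'a \<Rightarrow> 'a set" where
  "normal_cone Om v0 =
     (if v0 \<in> Om
      then {v'. \<exists>vs vs'. vs \<longlonglongrightarrow> v0 \<and> vs' \<longlonglongrightarrow> v' \<and>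
                         (\<forall>k::nat. vs' k \<in> frechet_normal_cone Om (vs k))}
      else {})"

definition gph :: "('a \<Rightarrow> 'b set) \<Rightarrow> ('a \<times> 'b) set" where
  "gph S = {(w, x). x \<in> S w}"

definition frechet_coderivative ::
  "('a::real_inner \<Rightarrow> 'b::real_inner set) \<Rightarrow> 'a \<Rightarrow> 'b \<Rightarrow> 'b \<Rightarrow> 'a set" where
  "frechet_coderivative S w0 x0 x' = {w'. (w', - x') \<in> frechet_normal_cone (gph S) (w0, x0)}"

definition coderivative ::
  "('a::real_inner \<Rightarrow> 'b::real_inner set) \<Rightarrow> 'a \<Rightarrow> 'b \<Rightarrow> 'b \<Rightarrow> 'a set" where
  "coderivative S w0 x0 x' = {w'. (w', - x') \<in> normal_cone (gph S) (w0, x0)}"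

definition feasible_set :: "((real^'n) \<times> (real^'d) \<Rightarrow> real) \<Rightarrow> real^'d \<Rightarrow> (real^'n) set" where
  "feasible_set F w = {x. F (x, w) \<le> 0}"

definition solution_map ::
  "((real^'n) \<times> (real^'d) \<Rightarrow> real) \<Rightarrow> ((real^'n) \<times> (real^'d) \<Rightarrow> real) \<Rightarrow> real^'d \<Rightarrow> (real^'n::finite) set" where
  "solution_map f0 F w = {x. 0 \<in> (+) (grad_x f0 x w) ` normal_cone (feasible_set F w) x}"

(* The block matrix [M c], with its argument in R^(n+1) split as a pair. *)
definition block_map :: "real^'n^'m \<Rightarrow> real^'m \<Rightarrow> (real^'n::finite) \<times> real \<Rightarrow> real^'m" where
  "block_map M c = (\<lambda>(v, \<gamma>). M *v v + \<gamma> *\<^sub>R c)"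

definition A1' :: "((real^'n) \<times> (real^'d) \<Rightarrow> real) \<Rightarrow> ((real^'n) \<times> (real^'d) \<Rightarrow> real) \<Rightarrow> real^'n \<Rightarrow> real^'d \<Rightarrow>
    (real^'n) \<times> real \<Rightarrow> real^'n::finite" where
  "A1' f0 F x w = block_map (hess_xx f0 x w) (grad_x F x w)"

definition A2' :: "((real^'n) \<times> (real^'d) \<Rightarrow> real) \<Rightarrow> ((real^'n) \<times> (real^'d) \<Rightarrow> real) \<Rightarrow> real^'n \<Rightarrow> real^'d \<Rightarrow>
    (real^'n::finite) \<times> real \<Rightarrow> real^'d::finite" where
  "A2' f0 F x w = block_map (hess_wx f0 x w) (grad_w F x w)"

definition ker :: "('a \<Rightarrow> 'b::zero) \<Rightarrow> 'a set" where
  "ker A = {z. A z = 0}"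

definition Gamma1_hat ::
  "((real^'n) \<times> (real^'d) \<Rightarrow> real) \<Rightarrow> ((real^'n) \<times> (real^'d) \<Rightarrow> real) \<Rightarrow> real^'n \<Rightarrow> real^'d \<Rightarrow>
   real^'n::finite \<Rightarrow> (real^'d::finite) set" where
  "Gamma1_hat f0 F x w x' =
     {w'. \<exists>v \<gamma>. w' = hess_wx f0 x w *v v + \<gamma> *\<^sub>R grad_w F x w \<and>
                 hess_xx f0 x w *v v + \<gamma> *\<^sub>R grad_x F x w = - x' \<and>
                 inner (grad_x F x w) v \<ge> 0 \<and> \<gamma> \<ge> 0}"

definition Gamma3 ::
  "((real^'n) \<times> (real^'d) \<Rightarrow> real) \<Rightarrow> ((real^'n) \<times> (real^'d) \<Rightarrow> real) \<Rightarrow> real^'n \<Rightarrow> real^'d \<Rightarrow>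
   real^'n::finite \<Rightarrow> (real^'d::finite) set" where
  "Gamma3 f0 F x w x' =
     {w'. \<exists>v \<gamma>. w' = hess_wx f0 x w *v v + \<gamma> *\<^sub>R grad_w F x w \<and>
                 hess_xx f0 x w *v v + \<gamma> *\<^sub>R grad_x F x w = - x' \<and>
                 (inner (grad_x F x w) v = 0 \<or>
                  inner (grad_x F x w) v > 0 \<and> \<gamma> \<ge> 0 \<or>
                  inner (grad_x F x w) v < 0 \<and> \<gamma> = 0)}"

end

(* For a C1 map Phi whose derivative is onto at p, normals of the preimage of K at p are D Phi(p)^T
   applied to normals of K at Phi(p). Near (wbar, xbar) the point x solves the problem at w iff some
   multiplier l satisfies F <= 0, l >= 0, l F = 0 and grad_x f0 + l grad_x F = 0; so the graph is locally the
   projection of the preimage of a complementarity set under the map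
     Phi((w, x), l) = (grad_x f0 + l grad_x F, F, l),
   and a normal of the graph, extended by 0, is a normal of that preimage. The kernel condition says
   exactly that D Phi is onto at ((wbar, xbar), 0), and the three alternatives of Gamma3 describe the
   normals (v, gamma, mu) of the complementarity set at the origin, with mu = - <grad_x F, v>.
   For (i), the first-order expansion of <v, grad_x f0> + gamma F is at most -l <v, grad_x F> on the
   graph, and l tends to 0 there. *)
theory Submission
  imports Defs
begin

section \<open>Normal cones of preimages\<close>

text \<open>Multiplying the quotient by the norm removes the division. At \<open>v = v0\<close> both
  sides of the inequality vanish, so the punctured neighbourhood of the limsup becomes a full ball.
  Arguments about Frechet normals below go through this form.\<close>

lemma frechet_normal_cone_iff:
  "v' \<in> frechet_normal_cone Om v0 \<longleftrightarrow> v0 \<in> Om \<and>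
     (\<forall>e>0. \<exists>d>0. \<forall>v\<in>Om. norm (v - v0) < d \<longrightarrow> inner v' (v - v0) \<le> e * norm (v - v0))"
proof (cases "v0 \<in> Om")
  case True
  let ?q = "\<lambda>v. inner v' (v - v0) / norm (v - v0)"
  have "v' \<in> frechet_normal_cone Om v0 \<longleftrightarrow> (\<forall>y>0. \<forall>\<^sub>F v in at v0 within Om. ereal (?q v) < y)"
    using True by (simp add: frechet_normal_cone_def Limsup_le_iff)
  \<comment> \<open>Real thresholds suffice: below every positive extended real lies a positive
    real.\<close>
  also have "\<dots> \<longleftrightarrow> (\<forall>e>0. \<forall>\<^sub>F v in at v0 within Om. ?q v < e)"
  proof safe
    fix e :: real assume *: "\<forall>y>0. \<forall>\<^sub>F v in at v0 within Om. ereal (?q v) < y" and "e > 0"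
    then have "\<forall>\<^sub>F v in at v0 within Om. ereal (?q v) < ereal e" using *[rule_format, of "ereal e"] by simp
    then show "\<forall>\<^sub>F v in at v0 within Om. ?q v < e" by simp
  next
    fix y :: ereal assume *: "\<forall>e>0. \<forall>\<^sub>F v in at v0 within Om. ?q v < e" and "y > 0"
    then obtain e where e: "e > 0" "ereal e < y"
      using ereal_dense2[of 0 y] by (auto simp flip: zero_ereal_def)
    with * have "\<forall>\<^sub>F v in at v0 within Om. ?q v < e" by blast
    then show "\<forall>\<^sub>F v in at v0 within Om. ereal (?q v) < y"
      by (rule eventually_mono) (use e(2) in \<open>metis less_ereal.simps(1) order_less_trans\<close>)
  qed
  also have "\<dots> \<longleftrightarrow> (\<forall>e>0. \<exists>d>0. \<forall>v\<in>Om. norm (v - v0) < d \<longrightarrow> inner v' (v - v0) \<le> e * norm (v - v0))"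
  proof safe
    fix e :: real assume *: "\<forall>e>0. \<forall>\<^sub>F v in at v0 within Om. ?q v < e" and "e > 0"
    then have "\<forall>\<^sub>F v in at v0 within Om. ?q v < e" by blast
    then obtain d where d: "d > 0" "\<And>v. v \<in> Om \<Longrightarrow> v \<noteq> v0 \<Longrightarrow> dist v v0 < d \<Longrightarrow> ?q v < e"
      unfolding eventually_at by auto
    have "inner v' (v - v0) \<le> e * norm (v - v0)" if "v \<in> Om" "norm (v - v0) < d" for v
      using d(2)[of v] that by (cases "v = v0") (auto simp: dist_norm field_simps)
    with d(1) show "\<exists>d>0. \<forall>v\<in>Om. norm (v - v0) < d \<longrightarrow> inner v' (v - v0) \<le> e * norm (v - v0)"
      by blast
  next
    fix e :: real
    assume *: "\<forall>e>0. \<exists>d>0. \<forall>v\<in>Om. norm (v - v0) < d \<longrightarrow> inner v' (v - v0) \<le> e * norm (v - v0)" and "e > 0"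
    \<comment> \<open>Half of \<open>e\<close> turns the non-strict bound into a strict one.\<close>
    then obtain d where d: "d > 0" "\<And>v. v \<in> Om \<Longrightarrow> norm (v - v0) < d \<Longrightarrow> inner v' (v - v0) \<le> (e/2) * norm (v - v0)"
      by (meson half_gt_zero)
    have "?q v < e" if "v \<in> Om" "v \<noteq> v0" "dist v v0 < d" for v
    proof -
      have "?q v \<le> e/2" using d(2)[of v] that by (simp add: dist_norm pos_divide_le_eq)
      then show ?thesis using \<open>e > 0\<close> by linarith
    qed
    with d(1) show "\<forall>\<^sub>F v in at v0 within Om. ?q v < e" unfolding eventually_at by blast
  qed
  finally show ?thesis using True by simp
qed (simp add: frechet_normal_cone_def)

text \<open>On the ray the normal inequality is divided by \<open>t\<close>, leaving a bound
  \<open>h * norm u\<close> that is as small as desired. Testing such directions is how kernels and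
  sign conditions are read off below.\<close>

lemma frechet_normal_feasible_direction:
  assumes q: "q \<in> frechet_normal_cone K c"
    and u: "\<forall>\<^sub>F t in at_right 0. c + t *\<^sub>R u \<in> K"
  shows "inner q u \<le> 0"
proof (rule field_le_epsilon)
  fix e :: real assume e: "e > 0"
  define h where "h = e / (norm u + 1)"
  have h: "h > 0" "h * norm u \<le> e" using e by (auto simp: h_def field_simps add_pos_nonneg)
  obtain d where d: "d > 0" "\<And>v. v \<in> K \<Longrightarrow> norm (v - c) < d \<Longrightarrow> inner q (v - c) \<le> h * norm (v - c)"
    using q h(1) unfolding frechet_normal_cone_iff by blast
  have "((\<lambda>t::real. norm (t *\<^sub>R u)) \<longlongrightarrow> norm (0 *\<^sub>R u)) (at_right 0)"
    by (intro tendsto_intros)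
  then have "\<forall>\<^sub>F t in at_right (0::real). norm (t *\<^sub>R u) < d"
    using d(1) by (auto dest: order_tendstoD(2))
  moreover have "\<forall>\<^sub>F t in at_right (0::real). t > 0" by (simp add: eventually_at_right_less)
  ultimately have "\<forall>\<^sub>F t in at_right (0::real). t > 0 \<and> norm (t *\<^sub>R u) < d \<and> c + t *\<^sub>R u \<in> K"
    using u by eventually_elim auto
  then obtain t :: real where t: "t > 0" "norm (t *\<^sub>R u) < d" "c + t *\<^sub>R u \<in> K"
    using eventually_happens'[OF trivial_limit_at_right_real] by blast
  from d(2)[OF t(3)] t have "t * inner q u \<le> t * (h * norm u)" by (auto simp: algebra_simps)
  then show "inner q u \<le> 0 + e" using t(1) h(2) by simp
qed

lemma frechet_normal_subset_normal: "frechet_normal_cone Om v0 \<subseteq> normal_cone Om v0"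
proof
  fix v' assume v': "v' \<in> frechet_normal_cone Om v0"
  then have "v0 \<in> Om" by (simp add: frechet_normal_cone_iff)
  with v' show "v' \<in> normal_cone Om v0"
    using tendsto_const[of v0 sequentially] tendsto_const[of v' sequentially]
    unfolding normal_cone_def if_P[OF \<open>v0 \<in> Om\<close>] by blast
qed

section \<open>The preimage rule under a surjective derivative\<close>

lemma norm_blinfun_le: "norm x \<le> c \<Longrightarrow> norm (blinfun_apply A x) \<le> norm A * c"
  by (rule order_trans[OF norm_blinfun]) (auto intro: mult_left_mono)

text \<open>The linearised equation \<open>D p + s = y - Psi z0\<close> is solved exactly by
  \<open>s = y - Psi z0 - D p\<close>, and the linearisation error is of smaller order than the
  displacement, so a true solution lies in a small ball around this \<open>s\<close>. The relative
  error \<open>e\<close> suffices because Frechet normals are themselves tested only up to such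
  errors.\<close>

lemma approximate_right_inverse:
  fixes Psi :: "'a::real_normed_vector \<Rightarrow> 'b::euclidean_space"
  assumes der: "(Psi has_derivative blinfun_apply D) (at z0)"
    and cont: "continuous_on UNIV Psi"
    and R: "\<And>s. D (blinfun_apply R s) = s" and "e > 0"
  shows "\<exists>d>0. \<forall>p y. norm p + norm (y - Psi z0) < d \<longrightarrow>
    (\<exists>s. norm (s - (y - Psi z0 - D p)) \<le> e * (norm p + norm (y - Psi z0)) \<and> Psi (z0 + p + R s) = y)"
proof -
  \<comment> \<open>\<open>C * r\<close> bounds the total displacement \<open>p + R s\<close> for
    \<open>s\<close> in the ball used below, and \<open>h = e / C\<close> then bounds the
    linearisation error by \<open>e * r\<close>.\<close>
  define C where "C = 1 + norm R * (1 + norm D + e)"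
  have C: "C > 0" using \<open>e > 0\<close> by (auto simp: C_def intro!: add_pos_nonneg)
  define h where "h = e / C"
  have h: "h > 0" using C \<open>e > 0\<close> by (simp add: h_def)
  obtain d where d: "d > 0" and derd: "\<And>z. norm (z - z0) < d \<Longrightarrow> norm (Psi z - Psi z0 - D (z - z0)) \<le> h * norm (z - z0)"
    using der h unfolding has_derivative_at_alt by blast
  have "\<exists>s. norm (s - (y - Psi z0 - D p)) \<le> e * (norm p + norm (y - Psi z0)) \<and> Psi (z0 + p + R s) = y"
    if small: "norm p + norm (y - Psi z0) < d / C" for p y
  proof -
    define r where "r = norm p + norm (y - Psi z0)"
    define m where "m = y - Psi z0 - D p"
    have r: "r \<ge> 0" "norm p \<le> r" "norm (y - Psi z0) \<le> r" by (auto simp: r_def)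
    have "norm m \<le> norm (y - Psi z0) + norm (D p)" unfolding m_def by (rule norm_triangle_ineq4)
    also have "\<dots> \<le> r + norm D * r"
      using r by (intro add_mono norm_blinfun_le)
    finally have m: "norm m \<le> (1 + norm D) * r" by (simp add: algebra_simps)
    \<comment> \<open>A modified Newton map; its fixed points solve the equation, and Brouwer's theorem needs
      differentiability at \<open>z0\<close> only.\<close>
    let ?T = "\<lambda>s. s - Psi (z0 + p + R s) + y"
    obtain s where "s \<in> cball m (e * r)" "?T s = s"
    proof (rule brouwer)
      show "compact (cball m (e * r))" "convex (cball m (e * r))" by auto
      show "cball m (e * r) \<noteq> {}" using \<open>e > 0\<close> r by (simp add: not_less)
      show "continuous_on (cball m (e * r)) ?T"
        by (intro continuous_intros continuous_on_compose2[OF cont]) auto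
      show "?T \<in> cball m (e * r) \<rightarrow> cball m (e * r)"
      proof
        fix s assume "s \<in> cball m (e * r)"
        then have "norm (s - m) \<le> e * r" by (simp add: dist_norm norm_minus_commute)
        then have s: "norm s \<le> (1 + norm D + e) * r"
          using m norm_triangle_sub[of s m] by (simp add: algebra_simps)
        have "norm (p + R s) \<le> norm p + norm (R s)" by (rule norm_triangle_ineq)
        also have "\<dots> \<le> r + norm R * ((1 + norm D + e) * r)"
          using r s by (intro add_mono norm_blinfun_le)
        also have "\<dots> = C * r" by (simp add: C_def algebra_simps)
        finally have Rs: "norm (p + R s) \<le> C * r" .
        also have "\<dots> < d" using small C by (simp add: r_def field_simps)
        finally have "norm (Psi (z0 + p + R s) - Psi z0 - D (p + R s)) \<le> h * norm (p + R s)"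
          using derd[of "z0 + p + R s"] by (simp add: algebra_simps)
        also have "\<dots> \<le> h * (C * r)" using Rs h by (intro mult_left_mono) auto
        also have "\<dots> = e * r" using C by (simp add: h_def)
        \<comment> \<open>Since \<open>D (p + R s) = D p + s\<close>, the linearisation remainder is
          exactly \<open>m - ?T s\<close>, so bounding it shows that \<open>?T\<close> maps the ball
          into itself.\<close>
        also have "Psi (z0 + p + R s) - Psi z0 - D (p + R s) = m - ?T s"
          by (simp add: m_def blinfun.add_right R)
        finally show "?T s \<in> cball m (e * r)" by (simp add: dist_norm)
      qed
    qed
    then show ?thesis
      by (intro exI[of _ s]) (auto simp: r_def m_def dist_norm norm_minus_commute)
  qed
  then show ?thesis using d C by (intro exI[of _ "d / C"]) auto
qed

text \<open>A point \<open>y\<close> of \<open>K\<close> near \<open>Psi z0\<close> and a small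
  kernel vector \<open>p\<close> of \<open>D\<close> together lift to a point
  \<open>z0 + p + R s\<close> of the preimage with \<open>s\<close> close to
  \<open>y - Psi z0\<close>. The normal inequality at that point gives \<open>key\<close>. Its case
  \<open>p = 0\<close> makes \<open>q\<close> a normal of \<open>K\<close>, and its case
  \<open>y = Psi z0\<close> makes \<open>z'\<close> vanish on the kernel of
  \<open>D\<close>.\<close>

lemma frechet_normal_cone_vimage:
  fixes Psi :: "'a::euclidean_space \<Rightarrow> 'b::euclidean_space"
  assumes der: "(Psi has_derivative blinfun_apply D) (at z0)"
    and cont: "continuous_on UNIV Psi"
    and surj: "surj (blinfun_apply D)"
    and z': "z' \<in> frechet_normal_cone (Psi -` K) z0"
  shows "\<exists>q\<in>frechet_normal_cone K (Psi z0). \<forall>u. inner z' u = inner q (D u)"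
proof -
  obtain R0 where R0: "linear R0" "blinfun_apply D \<circ> R0 = id"
    using linear_surjective_right_inverse[OF bounded_linear.linear[OF blinfun.bounded_linear_right] surj] by blast
  define R where "R = Blinfun R0"
  have R: "D (blinfun_apply R s) = s" for s
    using R0 by (simp add: R_def bounded_linear_Blinfun_apply linear_linear pointfree_idE)
  \<comment> \<open>Since \<open>z'\<close> will turn out to vanish on the kernel of \<open>D\<close>, it is determined by its values on the range of \<open>R\<close>.\<close>
  define q where "q = adjoint (blinfun_apply R) z'"
  have q: "inner z' (R s) = inner q s" for s
    unfolding q_def by (metis adjoint_works blinfun.bounded_linear_right bounded_linear.linear inner_commute)
  have z0: "Psi z0 \<in> K" using z' by (simp add: frechet_normal_cone_iff)
  have key: "\<exists>d>0. \<forall>p y. norm p + norm (y - Psi z0) < d \<longrightarrow> D p = 0 \<longrightarrow> y \<in> K \<longrightarrow>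
       inner z' p + inner q (y - Psi z0) \<le> e * (norm p + norm (y - Psi z0))" if "e > 0" for e
  proof -
    \<comment> \<open>Two errors are added up at the end, \<open>h * (1 + 2 * norm R) * r\<close>
      and \<open>norm q * h * r\<close>; this \<open>h\<close> makes their sum \<open>e * r\<close>.
      Capping \<open>k\<close> at 1 gives \<open>norm s \<le> 2 * r\<close>.\<close>
    define h where "h = e / (norm q + 1 + 2 * norm R)"
    define k where "k = min h 1"
    have pos: "norm q + 1 + 2 * norm R > 0" by (intro add_pos_nonneg add_nonneg_pos) auto
    have h: "h > 0" using that pos by (simp add: h_def)
    then have k: "k > 0" "k \<le> h" "k \<le> 1" by (auto simp: k_def)
    obtain d1 where d1: "d1 > 0" "\<And>z. Psi z \<in> K \<Longrightarrow> norm (z - z0) < d1 \<Longrightarrow> inner z' (z - z0) \<le> h * norm (z - z0)"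
      using z' h unfolding frechet_normal_cone_iff by (metis vimage_eq)
    obtain d2 where d2: "d2 > 0" "\<And>p y. norm p + norm (y - Psi z0) < d2 \<Longrightarrow>
       \<exists>s. norm (s - (y - Psi z0 - D p)) \<le> k * (norm p + norm (y - Psi z0)) \<and> Psi (z0 + p + R s) = y"
      using approximate_right_inverse[OF der cont R k(1)] by blast
    define C where "C = 1 + 2 * norm R"
    have C: "C > 0" by (auto simp: C_def intro!: add_pos_nonneg)
    have "inner z' p + inner q (y - Psi z0) \<le> e * (norm p + norm (y - Psi z0))"
      if small: "norm p + norm (y - Psi z0) < min d2 (d1 / C)" and p: "D p = 0" and y: "y \<in> K" for p y
    proof -
      define r where "r = norm p + norm (y - Psi z0)"
      have r: "r \<ge> 0" "norm p \<le> r" "norm (y - Psi z0) \<le> r" by (auto simp: r_def)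
      obtain s where s: "norm (s - (y - Psi z0)) \<le> k * r" "Psi (z0 + p + R s) = y"
        using d2(2)[of p y] small p by (auto simp: r_def)
      have kr: "k * r \<le> h * r" "k * r \<le> r" using k r by (auto intro: mult_right_mono mult_left_le_one_le)
      have ns: "norm s \<le> 2 * r" using s(1) r kr norm_triangle_sub[of s "y - Psi z0"] by linarith
      have "norm (p + R s) \<le> norm p + norm (R s)" by (rule norm_triangle_ineq)
      also have "\<dots> \<le> r + norm R * (2 * r)"
        using r ns by (intro add_mono norm_blinfun_le)
      also have "\<dots> = C * r" by (simp add: C_def algebra_simps)
      finally have Rs: "norm (p + R s) \<le> C * r" .
      also have "\<dots> < d1" using small C by (simp add: r_def field_simps)
      finally have "inner z' (p + R s) \<le> h * norm (p + R s)"
        using d1(2)[of "z0 + p + R s"] s(2) y by (simp add: algebra_simps)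
      also have "\<dots> \<le> h * (C * r)" using Rs h by (intro mult_left_mono) auto
      finally have 1: "inner z' p + inner q s \<le> h * (C * r)" by (simp add: inner_add_right q)
      have "inner q (y - Psi z0 - s) \<le> norm q * norm (y - Psi z0 - s)"
        by (rule norm_cauchy_schwarz)
      also have "\<dots> \<le> norm q * (h * r)"
        using s(1) kr by (intro mult_left_mono) (auto simp: norm_minus_commute)
      finally have "inner z' p + inner q (y - Psi z0) \<le> h * (C * r) + norm q * (h * r)"
        using 1 by (simp add: inner_diff_right)
      also have "\<dots> = h * (norm q + 1 + 2 * norm R) * r" by (simp add: C_def algebra_simps)
      also have "\<dots> = e * r" using pos by (simp add: h_def)
      finally show ?thesis by (simp add: r_def)
    qed
    then show ?thesis using d1(1) d2(1) C by (intro exI[of _ "min d2 (d1 / C)"]) auto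
  qed
  have "q \<in> frechet_normal_cone K (Psi z0)"
    unfolding frechet_normal_cone_iff
  proof (intro conjI allI impI z0)
    fix e :: real assume "e > 0"
    from key[OF this] obtain d where d: "d > 0" "\<And>p y. norm p + norm (y - Psi z0) < d \<Longrightarrow> D p = 0 \<Longrightarrow> y \<in> K \<Longrightarrow>
       inner z' p + inner q (y - Psi z0) \<le> e * (norm p + norm (y - Psi z0))" by blast
    show "\<exists>d>0. \<forall>v\<in>K. norm (v - Psi z0) < d \<longrightarrow> inner q (v - Psi z0) \<le> e * norm (v - Psi z0)"
      using d(1) d(2)[of 0] by (intro exI[of _ d]) (simp add: blinfun.zero_right)
  qed
  moreover have "inner z' u = inner q (D u)" for u
  proof -
    have "z' \<in> frechet_normal_cone {z. D (z - z0) = 0} z0"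
      unfolding frechet_normal_cone_iff
    proof (intro conjI allI impI)
      fix e :: real assume "e > 0"
      from key[OF this] obtain d where d: "d > 0" "\<And>p y. norm p + norm (y - Psi z0) < d \<Longrightarrow> D p = 0 \<Longrightarrow> y \<in> K \<Longrightarrow>
        inner z' p + inner q (y - Psi z0) \<le> e * (norm p + norm (y - Psi z0))" by blast
      show "\<exists>d>0. \<forall>v\<in>{z. D (z - z0) = 0}. norm (v - z0) < d \<longrightarrow> inner z' (v - z0) \<le> e * norm (v - z0)"
        using d(1) d(2)[OF _ _ z0] by (intro exI[of _ d]) simp
    qed (simp add: blinfun.zero_right)
    then have le: "inner z' p \<le> 0" if "D p = 0" for p
      by (rule frechet_normal_feasible_direction) (simp add: that blinfun.scaleR_right)
    have "inner z' p = 0" if "D p = 0" for p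
      using le[of p] le[of "- p"] that by (simp add: blinfun.minus_right)
    \<comment> \<open>The kernel component of \<open>u\<close> in the splitting given by
      \<open>R\<close>.\<close>
    from this[of "u - R (D u)"] show ?thesis
      by (simp add: blinfun.diff_right R inner_diff_right q)
  qed
  ultimately show ?thesis by blast
qed

text \<open>The Frechet rule is applied at the approximating points, where the derivative is still
  onto. The resulting normals \<open>q k\<close> stay bounded, and a limit of a convergent
  subsequence serves as the multiplier.\<close>

lemma normal_cone_vimage:
  fixes Psi :: "'a::euclidean_space \<Rightarrow> 'b::euclidean_space"
  assumes der: "\<And>z. (Psi has_derivative blinfun_apply (D z)) (at z)"
    and cont: "isCont D z0"
    and surj: "surj (blinfun_apply (D z0))"
    and z': "z' \<in> normal_cone (Psi -` K) z0"
  shows "\<exists>q\<in>normal_cone K (Psi z0). \<forall>u. inner z' u = inner q (D z0 u)"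
proof -
  have contPsi: "isCont Psi z" for z using der has_derivative_continuous by blast
  then have contU: "continuous_on UNIV Psi" by (simp add: continuous_at_imp_continuous_on)
  obtain R0 where R0: "linear R0" "blinfun_apply (D z0) \<circ> R0 = id"
    using linear_surjective_right_inverse[OF bounded_linear.linear[OF blinfun.bounded_linear_right] surj] by blast
  define R where "R = Blinfun R0"
  have R: "D z0 (blinfun_apply R s) = s" for s
    using R0 by (simp add: R_def bounded_linear_Blinfun_apply linear_linear pointfree_idE)
  from z' obtain zs zs' where z0: "Psi z0 \<in> K" and zs: "zs \<longlonglongrightarrow> z0" and zs': "zs' \<longlonglongrightarrow> z'"
    and N: "\<And>k::nat. zs' k \<in> frechet_normal_cone (Psi -` K) (zs k)"
    unfolding normal_cone_def by (auto split: if_splits)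
  have Dlim: "(\<lambda>k. D (zs k)) \<longlonglongrightarrow> D z0"
    using cont zs by (rule isCont_tendsto_compose)
  \<comment> \<open>The threshold makes \<open>D (zs k)\<close> composed with \<open>R\<close>
    differ from the identity by at most one half in norm, which forces injectivity and hence, in
    finite dimension, surjectivity.\<close>
  have "\<forall>\<^sub>F k in sequentially. dist (D (zs k)) (D z0) < 1 / (2 * (norm R + 1))"
    by (rule tendstoD[OF Dlim]) (auto intro!: divide_pos_pos add_nonneg_pos)
  then obtain k0 where k0: "\<And>k. k \<ge> k0 \<Longrightarrow> norm (D (zs k) - D z0) < 1 / (2 * (norm R + 1))"
    unfolding eventually_sequentially dist_norm by blast
  have near: "norm (D (zs k) (R u) - u) \<le> norm u / 2" if "k \<ge> k0" for k u
  proof -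
    have "norm (D (zs k) (R u) - u) = norm ((D (zs k) - D z0) (R u))"
      by (simp add: blinfun.diff_left R)
    also have "\<dots> \<le> norm (D (zs k) - D z0) * norm (R u)" by (rule norm_blinfun)
    also have "\<dots> \<le> (1 / (2 * (norm R + 1))) * (norm R * norm u)"
      using k0[OF that] norm_blinfun[of R u] by (intro mult_mono) auto
    also have "\<dots> = norm u / 2 * (norm R / (norm R + 1))" by (simp add: field_simps)
    also have "\<dots> \<le> norm u / 2 * 1"
      by (intro mult_left_mono) (auto simp: divide_le_eq_1 add_nonneg_pos)
    finally show ?thesis by simp
  qed
  have surjk: "surj (blinfun_apply (D (zs k)))" if "k \<ge> k0" for k
  proof -
    let ?A = "\<lambda>u. D (zs k) (R u)"
    have lin: "linear ?A" 
      by (intro bounded_linear.linear bounded_linear_intros)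
    have "u = 0" if "?A u = 0" for u using near[OF \<open>k \<ge> k0\<close>, of u] that by simp
    then have "inj ?A" using linear_injective_0[OF lin] by blast
    then have "surj ?A" using lin linear_injective_imp_surjective by blast
    then show ?thesis unfolding surj_def by blast
  qed
  have "\<exists>q\<in>frechet_normal_cone K (Psi (zs k)). \<forall>u. inner (zs' k) u = inner q (D (zs k) u)" if "k \<ge> k0" for k
    using frechet_normal_cone_vimage[OF der contU surjk[OF that] N] .
  then obtain q where q: "\<And>k. k \<ge> k0 \<Longrightarrow> q k \<in> frechet_normal_cone K (Psi (zs k))"
    "\<And>k u. k \<ge> k0 \<Longrightarrow> inner (zs' k) u = inner (q k) (D (zs k) u)"
    by metis
  \<comment> \<open>Test \<open>q k\<close> against \<open>D (zs k) (R (q k))\<close>, which is close to \<open>q k\<close>.\<close>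
  have qle: "norm (q k) \<le> 2 * norm R * norm (zs' k)" if "k \<ge> k0" for k
  proof -
    have "norm (q k) * norm (q k) = inner (q k) (q k)" by (metis norm_eq_sqrt_inner power2_eq_square power2_norm_eq_inner)
    also have "\<dots> = inner (q k) (D (zs k) (R (q k))) - inner (q k) (D (zs k) (R (q k)) - q k)"
      by (simp add: inner_diff_right)
    also have "\<dots> \<le> inner (zs' k) (R (q k)) + norm (q k) * norm (D (zs k) (R (q k)) - q k)"
      using Cauchy_Schwarz_ineq2[of "q k" "D (zs k) (R (q k)) - q k"] q(2)[OF that, of "R (q k)"] by linarith
    also have "\<dots> \<le> norm (zs' k) * (norm R * norm (q k)) + norm (q k) * (norm (q k) / 2)"
      using near[OF that, of "q k"] norm_blinfun[of R "q k"]
      by (intro add_mono mult_left_mono order_trans[OF norm_cauchy_schwarz]) auto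
    finally have "norm (q k) * norm (q k) \<le> norm (q k) * (2 * norm R * norm (zs' k))"
      by (simp add: algebra_simps)
    then show ?thesis by (cases "q k = 0") auto
  qed
  obtain B where B: "\<And>k. norm (zs' k) \<le> B"
    using zs' by (meson BseqE convergentI convergent_imp_Bseq)
  have "norm (q (k + k0)) \<le> 2 * norm R * B" for k
    using qle[of "k + k0"] B[of "k + k0"] by (intro order_trans[OF qle mult_left_mono]) auto
  then have "bounded (range (\<lambda>k. q (k + k0)))" by (auto simp: bounded_iff)
  then obtain l r where r: "strict_mono r" "((\<lambda>k. q (k + k0)) \<circ> r) \<longlonglongrightarrow> l"
    using bounded_imp_convergent_subsequence by blast
  \<comment> \<open>The shift by \<open>k0\<close> keeps every index in the range where
    \<open>q\<close> has its two properties.\<close>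
  define t where "t k = r k + k0" for k
  have t: "filterlim t sequentially sequentially"
    unfolding t_def using filterlim_compose[OF filterlim_add_const_nat_at_top filterlim_subseq[OF r(1)]] .
  have tk: "t k \<ge> k0" for k by (simp add: t_def)
  have ql: "(\<lambda>k. q (t k)) \<longlonglongrightarrow> l" using r(2) by (simp add: t_def comp_def)
  have zt: "(\<lambda>k. zs (t k)) \<longlonglongrightarrow> z0" using filterlim_compose[OF zs t] .
  have zt': "(\<lambda>k. zs' (t k)) \<longlonglongrightarrow> z'" using filterlim_compose[OF zs' t] .
  have Dt: "(\<lambda>k. D (zs (t k))) \<longlonglongrightarrow> D z0" using filterlim_compose[OF Dlim t] .
  have Pt: "(\<lambda>k. Psi (zs (t k))) \<longlonglongrightarrow> Psi z0"
    using contPsi zt by (rule isCont_tendsto_compose)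
  have "l \<in> normal_cone K (Psi z0)"
    unfolding normal_cone_def using z0 ql Pt q(1)[OF tk] by auto
  moreover have "inner z' u = inner l (D z0 u)" for u
  proof (rule LIMSEQ_unique)
    show "(\<lambda>k. inner (zs' (t k)) u) \<longlonglongrightarrow> inner z' u" by (intro tendsto_intros zt')
    have "(\<lambda>k. inner (q (t k)) (D (zs (t k)) u)) \<longlonglongrightarrow> inner l (D z0 u)"
      by (intro tendsto_intros ql blinfun.tendsto Dt)
    then show "(\<lambda>k. inner (zs' (t k)) u) \<longlonglongrightarrow> inner l (D z0 u)"
      by (simp add: q(2)[OF tk])
  qed
  ultimately show ?thesis by blast
qed

text \<open>Removes an auxiliary variable (the multiplier) from a graph.\<close>

lemma frechet_normal_cone_lift:
  assumes "z \<in> frechet_normal_cone Om (fst p0)" and "p0 \<in> M" and "fst ` M \<subseteq> Om"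
  shows "(z, 0) \<in> frechet_normal_cone M p0"
  unfolding frechet_normal_cone_iff
proof (intro conjI allI impI assms(2))
  fix e :: real assume "e > 0"
  then obtain d where d: "d > 0" "\<And>v. v \<in> Om \<Longrightarrow> norm (v - fst p0) < d \<Longrightarrow> inner z (v - fst p0) \<le> e * norm (v - fst p0)"
    using assms(1) unfolding frechet_normal_cone_iff by blast
  have "inner (z, 0) (p - p0) \<le> e * norm (p - p0)" if "p \<in> M" "norm (p - p0) < d" for p
  proof -
    have le: "norm (fst p - fst p0) \<le> norm (p - p0)"
      by (metis fst_diff norm_fst_le prod.collapse)
    have "inner (z, 0) (p - p0) = inner z (fst p - fst p0)"
      by (simp add: inner_prod_def fst_diff)
    also have "\<dots> \<le> e * norm (fst p - fst p0)"
      using that le assms(3) by (intro d(2)) auto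
    also have "\<dots> \<le> e * norm (p - p0)" using le \<open>e > 0\<close> by simp
    finally show ?thesis .
  qed
  with d(1) show "\<exists>d>0. \<forall>p\<in>M. norm (p - p0) < d \<longrightarrow> inner (z, 0) (p - p0) \<le> e * norm (p - p0)" by blast
qed

section \<open>Normal cones of half-lines and complementarity sets\<close>

text \<open>A limiting normal is a limit of pairs (base point, Frechet normal), so a closed
  condition on such pairs survives. This reduces the two computations below to Frechet
  normals.\<close>

lemma normal_cone_limit_property:
  assumes q: "q \<in> normal_cone K c" and "closed {p. P p}"
    and P: "\<And>y p. p \<in> frechet_normal_cone K y \<Longrightarrow> P (y, p)"
  shows "P (c, q)"
proof -
  obtain ys ps where "ys \<longlonglongrightarrow> c" "ps \<longlonglongrightarrow> q" "\<And>k::nat. ps k \<in> frechet_normal_cone K (ys k)"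
    using q unfolding normal_cone_def by (auto split: if_splits)
  then show ?thesis
    using closed_sequentially[OF assms(2), of "\<lambda>k. (ys k, ps k)" "(c, q)"] P
    by (auto intro!: tendsto_Pair)
qed

text \<open>The product form \<open>q * a = 0\<close> replaces a case distinction on
  \<open>a < 0\<close> and is closed in the pair, as the limit argument requires.\<close>

lemma normal_cone_atMost_zero:
  assumes "q \<in> normal_cone {..0::real} a"
  shows "q \<ge> 0 \<and> q * a = 0"
proof -
  have "(\<lambda>p. snd p \<ge> 0 \<and> snd p * fst p = 0) (a, q)"
  proof (rule normal_cone_limit_property[OF assms])
    show "closed {p::real \<times> real. snd p \<ge> 0 \<and> snd p * fst p = 0}"
      by (intro closed_Collect_conj closed_Collect_le closed_Collect_eq continuous_intros)
    fix y p :: real assume p: "p \<in> frechet_normal_cone {..0} y"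
    then have y: "y \<le> 0" by (simp add: frechet_normal_cone_iff)
    \<comment> \<open>Moving left is always feasible, moving right only from an interior point,
      where it forces \<open>p = 0\<close>.\<close>
    have "inner p (-1) \<le> 0"
      by (rule frechet_normal_feasible_direction[OF p], rule eventually_at_rightI[of 0 1]) (use y in auto)
    moreover have "inner p 1 \<le> 0" if "y < 0"
      by (rule frechet_normal_feasible_direction[OF p], rule eventually_at_rightI[of 0 "- y"]) (use that in auto)
    ultimately show "snd (y, p) \<ge> 0 \<and> snd (y, p) * fst (y, p) = 0" using y by force
  qed
  then show ?thesis by simp
qed

text \<open>The set consists of two legs meeting at a corner. On an open leg the normal component
  along that leg vanishes; at the corner both components have a sign. The disjunction of the three
  cases is closed and thus covers limits of normals from all three kinds of points.\<close>

lemma normal_cone_complementarity: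
  fixes q :: "'a::real_inner \<times> real \<times> real"
  assumes "q \<in> normal_cone {(0, a, b) |a b. a \<le> 0 \<and> b \<ge> 0 \<and> b * a = 0} c"
  shows "fst (snd q) = 0 \<or> snd (snd q) = 0 \<or> fst (snd q) \<ge> 0 \<and> snd (snd q) \<le> 0"
proof -
  let ?K = "{(0::'a, a::real, b::real) |a b. a \<le> 0 \<and> b \<ge> 0 \<and> b * a = 0}"
  have "(\<lambda>p::('a \<times> real \<times> real) \<times> ('a \<times> real \<times> real). fst (snd (snd p)) = 0 \<or> snd (snd (snd p)) = 0 \<or>
      fst (snd (snd p)) \<ge> 0 \<and> snd (snd (snd p)) \<le> 0) (c, q)"
  proof (rule normal_cone_limit_property[OF assms])
    show "closed {p::('a \<times> real \<times> real) \<times> ('a \<times> real \<times> real). fst (snd (snd p)) = 0 \<or> snd (snd (snd p)) = 0 \<or>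
      fst (snd (snd p)) \<ge> 0 \<and> snd (snd (snd p)) \<le> 0}"
      by (intro closed_Collect_conj closed_Collect_disj closed_Collect_le closed_Collect_eq continuous_intros)
    fix y p assume p: "p \<in> frechet_normal_cone ?K y"
    then obtain a b where y: "y = (0, a, b)" and ab: "a \<le> 0" "b \<ge> 0" "b * a = 0"
      by (auto simp: frechet_normal_cone_iff)
    \<comment> \<open>On an open leg \<open>r\<close> is the distance to the corner,
      \<open>- a\<close> or \<open>b\<close>, so both directions along the leg may be tested. At the
      corner only the two directions into the legs are tested.\<close>
    have dir: "fst (snd p) * s + snd (snd p) * t \<le> 0"
      if "r > 0" "\<And>x. 0 < x \<Longrightarrow> x < r \<Longrightarrow> a + x * s \<le> 0 \<and> b + x * t \<ge> 0 \<and> (b + x * t) * (a + x * s) = 0" for r s t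
    proof -
      have "inner p (0, s, t) \<le> 0"
        by (rule frechet_normal_feasible_direction[OF p], rule eventually_at_rightI[of 0 r])
          (use that y in auto)
      then show ?thesis by (simp add: inner_prod_def)
    qed
    consider "a < 0" "b = 0" | "a = 0" "b > 0" | "a = 0" "b = 0" using ab by force
    then show "fst (snd (snd (y, p))) = 0 \<or> snd (snd (snd (y, p))) = 0 \<or>
      fst (snd (snd (y, p))) \<ge> 0 \<and> snd (snd (snd (y, p))) \<le> 0"
    proof cases
      case 1
      then show ?thesis using dir[of "- a" 1 0] dir[of "- a" "-1" 0] by auto
    next
      case 2
      then show ?thesis using dir[of b 0 1] dir[of b 0 "-1"] by auto
    next
      case 3
      then show ?thesis using dir[of 1 "-1" 0] dir[of 1 0 1] by auto
    qed
  qed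
  then show ?thesis by simp
qed

section \<open>Gradients and the solution map\<close>

lemma partial_deriv_eq:
  assumes "(g has_derivative g') (at v)"
  shows "partial_deriv g i v = g' (axis i 1)"
proof -
  have lin: "bounded_linear g'" using assms by (rule has_derivative_bounded_linear)
  have "((\<lambda>t. g (v + t *\<^sub>R axis i 1)) has_derivative (\<lambda>t. g' (t *\<^sub>R axis i 1))) (at 0)"
    by (rule has_derivative_compose[where g = g and f = "\<lambda>t. v + t *\<^sub>R axis i 1"])
      (use assms in \<open>auto intro!: derivative_eq_intros\<close>)
  then have "((\<lambda>t. g (v + t *\<^sub>R axis i 1)) has_real_derivative g' (axis i 1)) (at 0)"
    by (rule has_derivative_imp_has_field_derivative)
      (simp add: linear_cmul[OF bounded_linear.linear[OF lin]])
  then show ?thesis unfolding partial_deriv_def by (rule DERIV_imp_deriv)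
qed

lemma linear_axis_expansion:
  fixes h :: "real^'n \<Rightarrow> 'b::real_vector"
  assumes "linear h"
  shows "h v = (\<Sum>i\<in>UNIV. v $ i *\<^sub>R h (axis i 1))"
proof -
  have "h v = h (\<Sum>i\<in>UNIV. v $ i *\<^sub>R axis i 1)"
    using basis_expansion[of v] by (simp add: scalar_mult_eq_scaleR)
  then show ?thesis by (simp add: linear_sum[OF assms] linear_cmul[OF assms])
qed

text \<open>Translates the entrywise definitions into bounded linear maps. The first index of the
  Hessian blocks is the differentiation variable, so multiplying by a block is the adjoint of the
  corresponding partial derivative of \<open>grad_x\<close>.\<close>

lemma C2_derivatives:
  fixes f :: "(real^'n) \<times> (real^'d) \<Rightarrow> real"
  assumes "C2 f"
  obtains f' :: "(real^'n) \<times> (real^'d) \<Rightarrow> ((real^'n) \<times> (real^'d)) \<Rightarrow>\<^sub>L real"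
    and g' :: "(real^'n) \<times> (real^'d) \<Rightarrow> ((real^'n) \<times> (real^'d)) \<Rightarrow>\<^sub>L (real^'n)"
  where "\<And>z. (f has_derivative blinfun_apply (f' z)) (at z)" "continuous_on UNIV f'"
    "\<And>z. ((\<lambda>z. grad_x f (fst z) (snd z)) has_derivative blinfun_apply (g' z)) (at z)" "continuous_on UNIV g'"
    "\<And>x w v. inner (grad_x f x w) v = f' (x, w) (v, 0)"
    "\<And>x w u. inner (grad_w f x w) u = f' (x, w) (0, u)"
    "\<And>x w v y. inner (hess_xx f x w *v v) y = inner v (g' (x, w) (y, 0))"
    "\<And>x w v u. inner (hess_wx f x w *v v) u = inner v (g' (x, w) (0, u))"
proof -
  obtain f' f'' where f': "\<And>z. (f has_derivative blinfun_apply (f' z)) (at z)"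
    and f'': "\<And>z. (f' has_derivative blinfun_apply (f'' z)) (at z)" and cont: "continuous_on UNIV f''"
    using assms unfolding C2_def by blast
  have cf': "continuous_on UNIV f'"
    using f'' has_derivative_continuous by (blast intro: continuous_at_imp_continuous_on)
  have comp: "((\<lambda>s. h (a s)) has_derivative (\<lambda>s. h' (a' s))) (at s)"
    if "(a has_derivative a') (at s)" "(h has_derivative h') (at (a s))" for h h' a a' s
    using has_derivative_compose[OF that] .
  have inj1: "((\<lambda>y. (y, w)) has_derivative (\<lambda>y. (y, 0))) (at x)" for x :: "real^'n" and w :: "real^'d"
    by (auto intro!: derivative_eq_intros)
  have inj2: "((\<lambda>u. (x, u)) has_derivative (\<lambda>u. (0, u))) (at w)" for x :: "real^'n" and w :: "real^'d"
    by (auto intro!: derivative_eq_intros)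
  have bl1: "bounded_linear (\<lambda>y::real^'n. (y, 0::real^'d))" and bl2: "bounded_linear (\<lambda>u::real^'d. (0::real^'n, u))"
    by (auto intro!: bounded_linear_Pair bounded_linear_intros)
  have lin1: "linear (\<lambda>y::real^'n. blinfun_apply A (y, 0::real^'d))" and lin2: "linear (\<lambda>u::real^'d. blinfun_apply A (0::real^'n, u))"
    for A :: "((real^'n) \<times> (real^'d)) \<Rightarrow>\<^sub>L 'z::real_normed_vector"
    by (rule bounded_linear.linear[OF bounded_linear_compose[OF blinfun.bounded_linear_right bl1]],
        rule bounded_linear.linear[OF bounded_linear_compose[OF blinfun.bounded_linear_right bl2]])
  have gx: "grad_x f x w $ i = f' (x, w) (axis i 1, 0)" for x w i
    unfolding grad_x_def by (simp add: partial_deriv_eq[OF comp[OF inj1 f']])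
  have gw: "grad_w f x w $ i = f' (x, w) (0, axis i 1)" for x w i
    unfolding grad_w_def by (simp add: partial_deriv_eq[OF comp[OF inj2 f']])
  have 1: "inner (grad_x f x w) v = f' (x, w) (v, 0)" for x w v
    by (subst linear_axis_expansion[OF lin1]) (simp add: inner_vec_def gx mult.commute)
  have 2: "inner (grad_w f x w) u = f' (x, w) (0, u)" for x w u
    by (subst linear_axis_expansion[OF lin2]) (simp add: inner_vec_def gw mult.commute)
  \<comment> \<open>\<open>L\<close> reads the \<open>x\<close>-gradient vector off a functional on
    the product. It is linear, so the gradient is differentiated by composing \<open>L\<close> with
    the second derivative.\<close>
  define L where "L = Blinfun (\<lambda>A::((real^'n) \<times> (real^'d)) \<Rightarrow>\<^sub>L real. \<Sum>i\<in>UNIV. A (axis i 1, 0) *\<^sub>R (axis i 1 :: real^'n))"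
  have L: "blinfun_apply L A = (\<Sum>i\<in>UNIV. A (axis i 1, 0) *\<^sub>R axis i 1)" for A
    unfolding L_def by (subst bounded_linear_Blinfun_apply) (intro bounded_linear_intros, rule refl)
  have Lgrad: "grad_x f (fst z) (snd z) = L (f' z)" for z
    unfolding L vec_eq_iff by (simp add: gx axis_def if_distrib cong: if_cong)
  define g' where "g' z = L o\<^sub>L f'' z" for z
  have g': "((\<lambda>z. grad_x f (fst z) (snd z)) has_derivative blinfun_apply (g' z)) (at z)" for z
    unfolding Lgrad g'_def blinfun_apply_blinfun_compose
    by (rule bounded_linear.has_derivative[OF blinfun.bounded_linear_right f''])
  have cg': "continuous_on UNIV g'" unfolding g'_def by (intro continuous_intros cont)
  have g'x: "((\<lambda>y. grad_x f y w $ j) has_derivative (\<lambda>y. g' (x, w) (y, 0) $ j)) (at x)" for x w j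
    using bounded_linear.has_derivative[OF bounded_linear_vec_nth comp[OF inj1 g']] by simp
  have g'w: "((\<lambda>u. grad_x f x u $ j) has_derivative (\<lambda>u. g' (x, w) (0, u) $ j)) (at w)" for x w j
    using bounded_linear.has_derivative[OF bounded_linear_vec_nth comp[OF inj2 g']] by simp
  have hx: "(hess_xx f x w *v v) $ i = inner v (g' (x, w) (axis i 1, 0))" for x w v i
    by (simp add: matrix_vector_mult_def hess_xx_def inner_vec_def partial_deriv_eq[OF g'x] mult.commute)
  have hw: "(hess_wx f x w *v v) $ i = inner v (g' (x, w) (0, axis i 1))" for x w v i
    by (simp add: matrix_vector_mult_def hess_wx_def inner_vec_def partial_deriv_eq[OF g'w] mult.commute)
  have 3: "inner (hess_xx f x w *v v) y = inner v (g' (x, w) (y, 0))" for x w v y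
    by (subst linear_axis_expansion[OF lin1], subst inner_vec_def) (simp add: hx inner_sum_right mult.commute)
  have 4: "inner (hess_wx f x w *v v) u = inner v (g' (x, w) (0, u))" for x w v u
    by (subst linear_axis_expansion[OF lin2], subst inner_vec_def) (simp add: hw inner_sum_right mult.commute)
  show thesis using that[OF f' cf' g' cg' 1 2 3 4] .
qed

text \<open>The feasible set is the preimage of a half-line under \<open>F\<close> at fixed
  \<open>w\<close>, and a nonzero gradient makes the derivative onto.\<close>

lemma normal_cone_feasible_set:
  fixes F :: "(real^'n) \<times> (real^'d) \<Rightarrow> real"
  assumes "C2 F" and nz: "grad_x F x w \<noteq> 0" and v': "v' \<in> normal_cone (feasible_set F w) x"
  shows "\<exists>l\<ge>0. l * F (x, w) = 0 \<and> v' = l *\<^sub>R grad_x F x w"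
proof -
  obtain f' where f': "\<And>z. (F has_derivative blinfun_apply (f' z)) (at z)" and cf': "continuous_on UNIV f'"
    and gr: "\<And>x w v. inner (grad_x F x w) v = f' (x, w) (v, 0)"
    by (rule C2_derivatives[OF assms(1)]) blast
  define E where "E = Blinfun (\<lambda>y::real^'n. (y, 0::real^'d))"
  have E: "blinfun_apply E = (\<lambda>y. (y, 0))"
    unfolding E_def by (rule bounded_linear_Blinfun_apply) (intro bounded_linear_Pair bounded_linear_intros)
  have der: "((\<lambda>y. F (y, w)) has_derivative blinfun_apply (f' (y, w) o\<^sub>L E)) (at y)" for y
    unfolding blinfun_apply_blinfun_compose E
    by (rule has_derivative_compose[OF _ f', of "\<lambda>y. (y, w)"]) (auto intro!: derivative_eq_intros)
  have "isCont (\<lambda>y. f' (y, w)) x"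
    by (rule isCont_o2[of _ "\<lambda>y. (y, w)"]) (use cf' in \<open>auto intro!: continuous_intros simp: continuous_on_eq_continuous_at\<close>)
  then have cont: "isCont (\<lambda>y. f' (y, w) o\<^sub>L E) x" by (intro continuous_intros)
  have "surj (blinfun_apply (f' (x, w) o\<^sub>L E))"
  proof (rule surjI)
    fix s :: real
    show "(f' (x, w) o\<^sub>L E) ((s / inner (grad_x F x w) (grad_x F x w)) *\<^sub>R grad_x F x w) = s"
      using nz by (simp add: E gr[symmetric])
  qed
  moreover have "feasible_set F w = (\<lambda>y. F (y, w)) -` {..0}" by (auto simp: feasible_set_def)
  ultimately obtain l where l: "l \<in> normal_cone {..0} (F (x, w))" "\<And>u. inner v' u = inner l ((f' (x, w) o\<^sub>L E) u)"
    using normal_cone_vimage[of "\<lambda>y. F (y, w)" "\<lambda>y. f' (y, w) o\<^sub>L E", OF der cont] v' by metis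
  have "inner v' u = inner (l *\<^sub>R grad_x F x w) u" for u
    using l(2)[of u] by (simp add: E gr[symmetric])
  then have "v' = l *\<^sub>R grad_x F x w" by (metis vector_eq_rdot)
  with normal_cone_atMost_zero[OF l(1)] show ?thesis by blast
qed

lemma solution_mapD:
  fixes F f0 :: "(real^'n) \<times> (real^'d) \<Rightarrow> real"
  assumes "C2 F" and "grad_x F x w \<noteq> 0" and "x \<in> solution_map f0 F w"
  obtains l where "l \<ge> 0" "F (x, w) \<le> 0" "l * F (x, w) = 0" "grad_x f0 x w + l *\<^sub>R grad_x F x w = 0"
proof -
  obtain v' where v': "v' \<in> normal_cone (feasible_set F w) x" "grad_x f0 x w + v' = 0"
    using assms(3) unfolding solution_map_def by auto
  then have "F (x, w) \<le> 0" by (auto simp: normal_cone_def feasible_set_def split: if_splits)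
  then show thesis using normal_cone_feasible_set[OF assms(1,2) v'(1)] v'(2) that by blast
qed

text \<open>On the feasible set \<open>l * F\<close> is at most 0, its value at \<open>x\<close>, so
  its gradient is a Frechet normal. The gradient of \<open>F\<close> may vanish here, so the
  inclusion \<open>proj\<close> below holds globally.\<close>

lemma solution_mapI:
  fixes F f0 :: "(real^'n) \<times> (real^'d) \<Rightarrow> real"
  assumes "C2 F" and l: "l \<ge> 0" "F (x, w) \<le> 0" "l * F (x, w) = 0" "grad_x f0 x w + l *\<^sub>R grad_x F x w = 0"
  shows "x \<in> solution_map f0 F w"
proof -
  obtain f' where f': "\<And>z. (F has_derivative blinfun_apply (f' z)) (at z)"
    and gr: "\<And>x w v. inner (grad_x F x w) v = f' (x, w) (v, 0)"
    by (rule C2_derivatives[OF assms(1)]) blast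
  \<comment> \<open>Differentiating \<open>l * F\<close> instead of \<open>F\<close> treats active
    and inactive constraints alike.\<close>
  have "((\<lambda>y. l * F (y, w)) has_derivative (\<lambda>y. l * f' (x, w) (y, 0))) (at x)"
    by (rule has_derivative_mult_right, rule has_derivative_compose[OF _ f', of "\<lambda>y. (y, w)"])
      (auto intro!: derivative_eq_intros)
  then have "((\<lambda>y. l * F (y, w)) has_derivative inner (l *\<^sub>R grad_x F x w)) (at x)"
    by (simp add: gr[symmetric] inner_scaleR_left[abs_def])
  then have der: "\<forall>e>0. \<exists>d>0. \<forall>y. norm (y - x) < d \<longrightarrow>
      norm (l * F (y, w) - l * F (x, w) - inner (l *\<^sub>R grad_x F x w) (y - x)) \<le> e * norm (y - x)"
    unfolding has_derivative_at_alt by blast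
  have "l *\<^sub>R grad_x F x w \<in> frechet_normal_cone (feasible_set F w) x"
    unfolding frechet_normal_cone_iff
  proof (intro conjI allI impI)
    show "x \<in> feasible_set F w" using l by (simp add: feasible_set_def)
    fix e :: real assume "e > 0"
    with der obtain d where d: "d > 0" "\<And>y. norm (y - x) < d \<Longrightarrow>
      norm (l * F (y, w) - l * F (x, w) - inner (l *\<^sub>R grad_x F x w) (y - x)) \<le> e * norm (y - x)" by blast
    have "inner (l *\<^sub>R grad_x F x w) (y - x) \<le> e * norm (y - x)"
      if "y \<in> feasible_set F w" "norm (y - x) < d" for y
    proof -
      have "l * F (y, w) \<le> 0" using that l(1) by (simp add: feasible_set_def mult_nonneg_nonpos)
      then show ?thesis using d(2)[OF that(2)] l(3) by (auto simp: abs_le_iff)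
    qed
    with d(1) show "\<exists>d>0. \<forall>y\<in>feasible_set F w. norm (y - x) < d \<longrightarrow>
        inner (l *\<^sub>R grad_x F x w) (y - x) \<le> e * norm (y - x)" by blast
  qed
  then have "l *\<^sub>R grad_x F x w \<in> normal_cone (feasible_set F w) x"
    using frechet_normal_subset_normal by blast
  then show ?thesis unfolding solution_map_def using l(4) by (metis (mono_tags) image_eqI mem_Collect_eq)
qed

section \<open>Coderivatives of the solution map\<close>

lemma Gamma1_hat_subset_frechet_coderivative:
  fixes f0 F :: "(real^'n) \<times> (real^'d) \<Rightarrow> real"
  assumes "C2 f0" and "C2 F"
    and sol: "xbar \<in> solution_map f0 F wbar" and F0: "F (xbar, wbar) = 0"
    and nz: "grad_x F xbar wbar \<noteq> 0" and G0: "grad_x f0 xbar wbar = 0"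
  shows "Gamma1_hat f0 F xbar wbar x' \<subseteq> frechet_coderivative (solution_map f0 F) wbar xbar x'"
proof
  fix w' assume "w' \<in> Gamma1_hat f0 F xbar wbar x'"
  then obtain v \<gamma> where w': "w' = hess_wx f0 xbar wbar *v v + \<gamma> *\<^sub>R grad_w F xbar wbar"
    and x': "hess_xx f0 xbar wbar *v v + \<gamma> *\<^sub>R grad_x F xbar wbar = - x'"
    and v: "inner (grad_x F xbar wbar) v \<ge> 0" and \<gamma>: "\<gamma> \<ge> 0"
    unfolding Gamma1_hat_def by blast
  define G where "G z = grad_x f0 (fst z) (snd z)" for z
  define g where "g z = grad_x F (fst z) (snd z)" for z
  define zb where "zb = (xbar, wbar)"
  obtain G' where G': "\<And>z. (G has_derivative blinfun_apply (G' z)) (at z)"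
    and hxx: "\<And>x w v y. inner (hess_xx f0 x w *v v) y = inner v (G' (x, w) (y, 0))"
    and hwx: "\<And>x w v u. inner (hess_wx f0 x w *v v) u = inner v (G' (x, w) (0, u))"
    unfolding G_def by (rule C2_derivatives[OF assms(1)]) blast
  obtain F' g' where F': "\<And>z. (F has_derivative blinfun_apply (F' z)) (at z)"
    and g': "\<And>z. (g has_derivative blinfun_apply (g' z)) (at z)"
    and gx: "\<And>x w v. inner (grad_x F x w) v = F' (x, w) (v, 0)"
    and gw: "\<And>x w u. inner (grad_w F x w) u = F' (x, w) (0, u)"
    unfolding g_def by (rule C2_derivatives[OF assms(2)]) blast
  have gb: "g zb \<noteq> 0" and Gb: "G zb = 0" and Fb: "F zb = 0" and vg: "inner v (g zb) \<ge> 0"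
    using nz G0 F0 v by (simp_all add: g_def G_def zb_def inner_commute)
  have cont: "isCont G z" "isCont g z" for z
    using G' g' has_derivative_continuous by blast+
  \<comment> \<open>By the adjoint identities, the derivative of \<open>h\<close> at
    \<open>zb\<close> is the pairing with \<open>(w', - x')\<close>, up to swapping the order of
    \<open>w\<close> and \<open>x\<close>.\<close>
  define h where "h z = inner v (G z) + \<gamma> * F z" for z
  \<comment> \<open>Near \<open>zb\<close>, \<open>g\<close> grows at most at rate
    \<open>norm (g' zb) + 1\<close>. As \<open>inner v (g zb)\<close> is nonnegative,
    \<open>- inner v (g z)\<close> is at most \<open>B * norm (z - zb)\<close>.\<close>
  define B where "B = norm v * (norm (g' zb) + 1)"
  have B: "B \<ge> 0" by (simp add: B_def)
  have h: "(h has_derivative (\<lambda>u. inner v (G' zb u) + \<gamma> * F' zb u)) (at zb)"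
    unfolding h_def by (intro derivative_intros G' F')
  have pairing: "inner (w', - x') ((w, x) - (wbar, xbar)) = inner v (G' zb ((x, w) - zb)) + \<gamma> * F' zb ((x, w) - zb)" for w x
  proof -
    have "G' zb (x - xbar, w - wbar) = G' zb (x - xbar, 0) + G' zb (0, w - wbar)"
      "F' zb (x - xbar, w - wbar) = F' zb (x - xbar, 0) + F' zb (0, w - wbar)"
      by (simp_all flip: blinfun.add_right)
    then show ?thesis
      unfolding w' x'[symmetric] zb_def
      by (simp add: inner_add_left inner_add_right hxx hwx gx gw distrib_left)
  qed
  have "(w', - x') \<in> frechet_normal_cone (gph (solution_map f0 F)) (wbar, xbar)"
    unfolding frechet_normal_cone_iff
  proof (intro conjI allI impI)
    show "(wbar, xbar) \<in> gph (solution_map f0 F)" using sol by (simp add: gph_def)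
    fix e :: real assume e: "e > 0"
    \<comment> \<open>\<open>r\<close> bounds the multiplier, so that the curvature term costs at
      most half of \<open>e\<close>; the other half absorbs the linearisation error of
      \<open>h\<close>.\<close>
    define r where "r = e / (2 * (B + 1))"
    have r: "r > 0" "r * B \<le> e / 2"
      using e B by (auto simp: r_def field_simps)
    have nhds: "(G \<longlongrightarrow> G zb) (nhds zb)" "(g \<longlongrightarrow> g zb) (nhds zb)"
      using cont[of zb] by (simp_all add: isCont_def tendsto_at_iff_tendsto_nhds)
    \<comment> \<open>This quotient is the multiplier at points of the graph, by
      \<open>G z + l *\<^sub>R g z = 0\<close>, and it is 0 at \<open>zb\<close>.\<close>
    then have "((\<lambda>z. norm (G z) / norm (g z)) \<longlongrightarrow> norm (G zb) / norm (g zb)) (nhds zb)"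
      using nhds gb by (intro tendsto_intros) auto
    then have e1: "\<forall>\<^sub>F z in nhds zb. norm (G z) / norm (g z) < r"
      using r(1) by (intro order_tendstoD) (auto simp: Gb)
    have e2: "\<forall>\<^sub>F z in nhds zb. g z \<noteq> 0"
      using nhds(2) gb by (rule tendsto_imp_eventually_ne)
    obtain d3 where d3: "d3 > 0" "\<And>z. norm (z - zb) < d3 \<Longrightarrow>
        norm (g z - g zb - g' zb (z - zb)) \<le> 1 * norm (z - zb)"
      using g'[of zb] zero_less_one unfolding has_derivative_at_alt by blast
    obtain d4 where d4: "d4 > 0" "\<And>z. norm (z - zb) < d4 \<Longrightarrow>
        norm (h z - h zb - (inner v (G' zb (z - zb)) + \<gamma> * F' zb (z - zb))) \<le> (e / 2) * norm (z - zb)"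
      using h half_gt_zero[OF e] unfolding has_derivative_at_alt by blast
    obtain d1 where d1: "d1 > 0" "\<And>z. norm (z - zb) < d1 \<Longrightarrow> norm (G z) / norm (g z) < r \<and> g z \<noteq> 0"
      using eventually_conj[OF e1 e2] unfolding eventually_nhds_metric dist_norm by blast
    define d where "d = min d1 (min d3 d4)"
    have "inner (w', - x') (p - (wbar, xbar)) \<le> e * norm (p - (wbar, xbar))"
      if p: "p \<in> gph (solution_map f0 F)" and near: "norm (p - (wbar, xbar)) < d" for p
    proof -
      obtain w x where wx: "p = (w, x)" by (cases p)
      define z where "z = (x, w)"
      have nz: "norm (z - zb) = norm (p - (wbar, xbar))"
        by (simp add: z_def zb_def wx norm_Pair add.commute)
      then have z: "norm (z - zb) < d1" "norm (z - zb) < d3" "norm (z - zb) < d4"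
        using near by (auto simp: d_def)
      have "x \<in> solution_map f0 F w" using p by (simp add: wx gph_def)
      then obtain l where l: "l \<ge> 0" "F z \<le> 0" "G z + l *\<^sub>R g z = 0"
        using solution_mapD[OF assms(2), of x w] d1(2)[OF z(1)] by (auto simp: G_def g_def z_def)
      have Gz: "G z = - l *\<^sub>R g z" using l(3) by (simp add: eq_neg_iff_add_eq_0)
      then have lr: "l < r" using d1(2)[OF z(1)] l(1) by (simp split: if_splits)
      have "norm (g z - g zb) \<le> norm (g' zb (z - zb)) + norm (z - zb)"
        using d3(2)[OF z(2)] norm_triangle_sub[of "g z - g zb" "g' zb (z - zb)"] by simp
      also have "\<dots> \<le> (norm (g' zb) + 1) * norm (z - zb)"
        using norm_blinfun[of "g' zb" "z - zb"] by (simp add: algebra_simps)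
      finally have "norm v * norm (g z - g zb) \<le> B * norm (z - zb)"
        unfolding B_def mult.assoc by (intro mult_left_mono) auto
      moreover have "- inner v (g z - g zb) \<le> norm v * norm (g z - g zb)"
        using Cauchy_Schwarz_ineq2[of v "g z - g zb"] by linarith
      ultimately have vB: "- inner v (g z) \<le> B * norm (z - zb)" using vg by (simp add: inner_diff_right)
      \<comment> \<open>Stationarity replaces \<open>G z\<close> by
        \<open>- l *\<^sub>R g z\<close>, and feasibility makes the term with
        \<open>\<gamma>\<close> nonpositive.\<close>
      have "h z \<le> l * (- inner v (g z))"
        using l(2) \<gamma> by (simp add: h_def Gz mult_nonneg_nonpos)
      also have "\<dots> \<le> l * (B * norm (z - zb))" using vB l(1) by (rule mult_left_mono)
      also have "\<dots> \<le> r * (B * norm (z - zb))" using lr B by (intro mult_right_mono) auto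
      also have "\<dots> \<le> e / 2 * norm (z - zb)"
        using mult_right_mono[OF r(2), of "norm (z - zb)"] by (simp add: mult.assoc)
      finally have "h z \<le> e / 2 * norm (z - zb)" .
      moreover have "h zb = 0" by (simp add: h_def Gb Fb)
      ultimately have "inner v (G' zb (z - zb)) + \<gamma> * F' zb (z - zb) \<le> e * norm (z - zb)"
        using d4(2)[OF z(3)] unfolding real_norm_def by linarith
      then show ?thesis unfolding nz[unfolded wx, symmetric] wx pairing z_def .
    qed
    moreover have "d > 0" using d1(1) d3(1) d4(1) by (simp add: d_def)
    ultimately show "\<exists>d>0. \<forall>p\<in>gph (solution_map f0 F). norm (p - (wbar, xbar)) < d \<longrightarrow>
        inner (w', - x') (p - (wbar, xbar)) \<le> e * norm (p - (wbar, xbar))" by blast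
  qed
  then show "w' \<in> frechet_coderivative (solution_map f0 F) wbar xbar x'"
    by (simp add: frechet_coderivative_def)
qed

text \<open>In finite dimension pointwise convergence of operators is norm convergence, so
  continuity of a derivative can be checked on its explicit formula for a fixed argument.\<close>

lemma isCont_blinfunI:
  fixes D :: "'c::t2_space \<Rightarrow> 'a::euclidean_space \<Rightarrow>\<^sub>L 'b::real_normed_vector"
  assumes "\<And>u. isCont (\<lambda>p. D p u) p0"
  shows "isCont D p0"
  using assms unfolding isCont_def by (intro tendsto_componentwise1)

lemma coderivative_subset_Gamma3:
  fixes f0 F :: "(real^'n) \<times> (real^'d) \<Rightarrow> real"
  assumes "C2 f0" and "C2 F"
    and F0: "F (xbar, wbar) = 0" and nz: "grad_x F xbar wbar \<noteq> 0" and G0: "grad_x f0 xbar wbar = 0"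
    and ker: "ker (A1' f0 F xbar wbar) \<inter> ker (A2' f0 F xbar wbar) = {0}"
  shows "coderivative (solution_map f0 F) wbar xbar x' \<subseteq> Gamma3 f0 F xbar wbar x'"
proof
  fix w' assume "w' \<in> coderivative (solution_map f0 F) wbar xbar x'"
  \<comment> \<open>The sequences are needed themselves: a multiplier is attached to each point
    before passing to the limit.\<close>
  then obtain ps ps' where ps: "ps \<longlonglongrightarrow> (wbar, xbar)" and ps': "ps' \<longlonglongrightarrow> (w', - x')"
    and N: "\<And>k::nat. ps' k \<in> frechet_normal_cone (gph (solution_map f0 F)) (ps k)"
    unfolding coderivative_def normal_cone_def by (auto split: if_splits)
  define G where "G z = grad_x f0 (fst z) (snd z)" for z
  define g where "g z = grad_x F (fst z) (snd z)" for z
  obtain G' where G': "\<And>z. (G has_derivative blinfun_apply (G' z)) (at z)" and cG': "continuous_on UNIV G'"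
    and hxx: "\<And>x w v y. inner (hess_xx f0 x w *v v) y = inner v (G' (x, w) (y, 0))"
    and hwx: "\<And>x w v u. inner (hess_wx f0 x w *v v) u = inner v (G' (x, w) (0, u))"
    unfolding G_def by (rule C2_derivatives[OF assms(1)]) blast
  obtain F' g' where F': "\<And>z. (F has_derivative blinfun_apply (F' z)) (at z)" and cF': "continuous_on UNIV F'"
    and g': "\<And>z. (g has_derivative blinfun_apply (g' z)) (at z)" and cg': "continuous_on UNIV g'"
    and gx: "\<And>x w v. inner (grad_x F x w) v = F' (x, w) (v, 0)"
    and gw: "\<And>x w u. inner (grad_w F x w) u = F' (x, w) (0, u)"
    unfolding g_def by (rule C2_derivatives[OF assms(2)]) blast
  have cont: "isCont G z" "isCont g z" for z
    using G' g' has_derivative_continuous by blast+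
  \<comment> \<open>The graph orders its variables as (w, x), the data functions as (x, w);
    \<open>s\<close> swaps them and drops the multiplier.\<close>
  define s :: "((real^'d) \<times> (real^'n)) \<times> real \<Rightarrow> (real^'n) \<times> (real^'d)"
    where "s p = (snd (fst p), fst (fst p))" for p
  define p0 where "p0 = ((wbar, xbar), 0::real)"
  have s0: "s p0 = (xbar, wbar)" by (simp add: s_def p0_def)
  have cs: "isCont s p" for p unfolding s_def by (intro continuous_intros)
  define Phi where "Phi p = (G (s p) + snd p *\<^sub>R g (s p), F (s p), snd p)" for p
  define DD where "DD p u = (G' (s p) (s u) + (snd p *\<^sub>R g' (s p) (s u) + snd u *\<^sub>R g (s p)), F' (s p) (s u), snd u)" for p u
  have derPhi: "(Phi has_derivative DD p) (at p)" for p
  proof -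
    have ds: "(s has_derivative s) (at p)" unfolding s_def by (intro derivative_intros)
    have "((\<lambda>p. G (s p)) has_derivative (\<lambda>u. G' (s p) (s u))) (at p)"
      "((\<lambda>p. g (s p)) has_derivative (\<lambda>u. g' (s p) (s u))) (at p)"
      "((\<lambda>p. F (s p)) has_derivative (\<lambda>u. F' (s p) (s u))) (at p)"
      by (rule has_derivative_compose[OF ds G'] has_derivative_compose[OF ds g'] has_derivative_compose[OF ds F'])+
    then show ?thesis unfolding Phi_def[abs_def] DD_def[abs_def]
      by (intro derivative_intros has_derivative_scaleR)
  qed
  define D where "D p = Blinfun (DD p)" for p
  have D: "blinfun_apply (D p) = DD p" for p
    unfolding D_def by (rule bounded_linear_Blinfun_apply[OF has_derivative_bounded_linear[OF derPhi]])
  have "isCont (\<lambda>p. D p u) p0" for u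
  proof -
    have "isCont (\<lambda>p. G' (s p)) p0" "isCont (\<lambda>p. g' (s p)) p0" "isCont (\<lambda>p. F' (s p)) p0" "isCont (\<lambda>p. g (s p)) p0"
      by (rule isCont_o2[OF cs], rule continuous_on_interior[OF cG'] continuous_on_interior[OF cg']
          continuous_on_interior[OF cF'] cont(2), simp?)+
    then show ?thesis unfolding D DD_def by (intro continuous_intros)
  qed
  then have contD: "isCont D p0" by (rule isCont_blinfunI)
  \<comment> \<open>The three summands are the components of the adjoint derivative at
    \<open>p0\<close>. The term with \<open>g'\<close> drops out because the multiplier there is
    0.\<close>
  have pairing: "inner (v, \<gamma>, \<mu>) (DD p0 ((u, y), t)) =
      inner (hess_wx f0 xbar wbar *v v + \<gamma> *\<^sub>R grad_w F xbar wbar) u +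
      inner (hess_xx f0 xbar wbar *v v + \<gamma> *\<^sub>R grad_x F xbar wbar) y +
      t * (inner (grad_x F xbar wbar) v + \<mu>)" for v \<gamma> \<mu> u y t
  proof -
    have "G' (xbar, wbar) (y, u) = G' (xbar, wbar) (y, 0) + G' (xbar, wbar) (0, u)"
      "F' (xbar, wbar) (y, u) = F' (xbar, wbar) (y, 0) + F' (xbar, wbar) (0, u)"
      by (simp_all flip: blinfun.add_right)
    moreover have "s ((u, y), t) = (y, u)" "snd p0 = 0" by (simp_all add: s_def p0_def)
    ultimately show ?thesis
      by (simp add: DD_def s0 inner_add_left inner_add_right hxx hwx gx[symmetric] gw g_def)
        (simp add: inner_commute algebra_simps)
  qed
  \<comment> \<open>Surjectivity is injectivity of the adjoint: its first two components put
    \<open>(v, \<gamma>)\<close> into both kernels, and the third then gives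
    \<open>\<mu> = 0\<close>.\<close>
  have surj: "surj (blinfun_apply (D p0))"
  proof -
    let ?A = "adjoint (blinfun_apply (D p0))"
    have lin: "linear (blinfun_apply (D p0))" by (intro bounded_linear.linear blinfun.bounded_linear_right)
    have "q = 0" if "?A q = 0" for q
    proof -
      obtain v \<gamma> \<mu> where q: "q = (v, \<gamma>, \<mu>)" by (cases q)
      have zero: "inner (v, \<gamma>, \<mu>) (DD p0 p) = 0" for p
        using adjoint_works[OF lin, of p q] that q by (simp add: D inner_commute)
      have "hess_wx f0 xbar wbar *v v + \<gamma> *\<^sub>R grad_w F xbar wbar = 0"
        using zero[of "((hess_wx f0 xbar wbar *v v + \<gamma> *\<^sub>R grad_w F xbar wbar, 0), 0)"] unfolding pairing by simp
      moreover have "hess_xx f0 xbar wbar *v v + \<gamma> *\<^sub>R grad_x F xbar wbar = 0"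
        using zero[of "((0, hess_xx f0 xbar wbar *v v + \<gamma> *\<^sub>R grad_x F xbar wbar), 0)"] unfolding pairing by simp
      ultimately have "(v, \<gamma>) \<in> ker (A1' f0 F xbar wbar) \<inter> ker (A2' f0 F xbar wbar)"
        by (simp add: ker_def A1'_def A2'_def block_map_def)
      then have "v = 0" "\<gamma> = 0" unfolding ker by (simp_all add: zero_prod_def)
      then show ?thesis using zero[of "((0, 0), 1)"] unfolding pairing by (simp add: q zero_prod_def)
    qed
    then have "inj ?A" using linear_injective_0[OF adjoint_linear[OF lin]] by blast
    then show ?thesis using lin by simp
  qed
  let ?K = "{(0::real^'n, a::real, b::real) |a b. a \<le> 0 \<and> b \<ge> 0 \<and> b * a = 0}"
  have proj: "fst ` (Phi -` ?K) \<subseteq> gph (solution_map f0 F)"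
    by (auto simp: Phi_def s_def G_def g_def gph_def intro!: solution_mapI[OF assms(2)])
  define m where "m p = (snd p, fst p)" for p :: "(real^'d) \<times> (real^'n)"
  have mps: "(\<lambda>k. m (ps k)) \<longlonglongrightarrow> (xbar, wbar)"
    unfolding m_def using tendsto_Pair[OF tendsto_snd[OF ps] tendsto_fst[OF ps]] by simp
  have gps: "(\<lambda>k. g (m (ps k))) \<longlonglongrightarrow> g (xbar, wbar)" "(\<lambda>k. G (m (ps k))) \<longlonglongrightarrow> G (xbar, wbar)"
    using isCont_tendsto_compose[OF cont(2) mps] isCont_tendsto_compose[OF cont(1) mps] by auto
  have g0: "g (xbar, wbar) \<noteq> 0" using nz by (simp add: g_def)
  \<comment> \<open>Where \<open>g\<close> is nonzero the nonnegative multiplier is unique and has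
    this norm quotient as its value, which makes its convergence to 0 visible.\<close>
  define l where "l k = norm (G (m (ps k))) / norm (g (m (ps k)))" for k
  have "l \<longlonglongrightarrow> norm (G (xbar, wbar)) / norm (g (xbar, wbar))"
    unfolding l_def using gps g0 by (intro tendsto_intros) auto
  then have l0: "l \<longlonglongrightarrow> 0" using G0 by (simp add: G_def)
  obtain k0 where k0: "\<And>k. k \<ge> k0 \<Longrightarrow> g (m (ps k)) \<noteq> 0"
    using tendsto_imp_eventually_ne[OF gps(1) g0] unfolding eventually_sequentially by blast
  have inM: "(ps k, l k) \<in> Phi -` ?K" if k: "k \<ge> k0" for k
  proof -
    obtain w x where wx: "ps k = (w, x)" by (cases "ps k")
    have "ps k \<in> gph (solution_map f0 F)" using N[of k] by (simp add: frechet_normal_cone_iff)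
    then have "x \<in> solution_map f0 F w" by (simp add: wx gph_def)
    then obtain r where r: "r \<ge> 0" "F (x, w) \<le> 0" "r * F (x, w) = 0" "G (x, w) + r *\<^sub>R g (x, w) = 0"
      using solution_mapD[OF assms(2), of x w] k0[OF k] by (auto simp: G_def g_def wx m_def)
    have "G (x, w) = - r *\<^sub>R g (x, w)" using r(4) by (simp add: eq_neg_iff_add_eq_0)
    then have "l k = r" using r(1) k0[OF k] by (simp add: l_def m_def wx)
    then show ?thesis using r by (simp add: Phi_def s_def wx)
  qed
  have Mk: "(ps' (k + k0), 0) \<in> frechet_normal_cone (Phi -` ?K) (ps (k + k0), l (k + k0))" for k
    by (rule frechet_normal_cone_lift[OF _ inM proj]) (simp_all add: N)
  have lim: "(\<lambda>k. (ps (k + k0), l (k + k0))) \<longlonglongrightarrow> p0" "(\<lambda>k. (ps' (k + k0), 0::real)) \<longlonglongrightarrow> ((w', - x'), 0)"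
    unfolding p0_def by (intro tendsto_Pair tendsto_const LIMSEQ_ignore_initial_segment ps ps' l0)+
  have "p0 \<in> Phi -` ?K"
    using F0 G0 by (simp add: Phi_def s0 G_def) (simp add: p0_def)
  then have "((w', - x'), 0) \<in> normal_cone (Phi -` ?K) p0"
    using lim Mk unfolding normal_cone_def by auto
  then obtain q where q: "q \<in> normal_cone ?K (Phi p0)" "\<And>u. inner ((w', - x'), 0) u = inner q (DD p0 u)"
    using normal_cone_vimage[of Phi D p0, unfolded D, OF derPhi contD surj[unfolded D]] by blast
  obtain v \<gamma> \<mu> where qv: "q = (v, \<gamma>, \<mu>)" by (cases q)
  have eq: "inner w' u - inner x' y = inner (hess_wx f0 xbar wbar *v v + \<gamma> *\<^sub>R grad_w F xbar wbar) u +
      inner (hess_xx f0 xbar wbar *v v + \<gamma> *\<^sub>R grad_x F xbar wbar) y +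
      t * (inner (grad_x F xbar wbar) v + \<mu>)" for u y t
    using q(2)[of "((u, y), t)"] unfolding qv pairing by simp
  have "inner w' u = inner (hess_wx f0 xbar wbar *v v + \<gamma> *\<^sub>R grad_w F xbar wbar) u" for u
    using eq[of u 0 0] by simp
  then have 1: "w' = hess_wx f0 xbar wbar *v v + \<gamma> *\<^sub>R grad_w F xbar wbar" by (metis vector_eq_rdot)
  have "inner (- x') y = inner (hess_xx f0 xbar wbar *v v + \<gamma> *\<^sub>R grad_x F xbar wbar) y" for y
    using eq[of 0 y 0] by simp
  then have 2: "hess_xx f0 xbar wbar *v v + \<gamma> *\<^sub>R grad_x F xbar wbar = - x'" by (metis vector_eq_rdot)
  \<comment> \<open>The lifted normal has last component 0. This ties \<open>\<mu>\<close> to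
    \<open>v\<close> and turns the corner condition on \<open>\<mu>\<close> into a sign of
    \<open>inner (grad_x F xbar wbar) v\<close>.\<close>
  have "\<mu> = - inner (grad_x F xbar wbar) v" using eq[of 0 0 1] by simp
  then have "\<gamma> = 0 \<or> inner (grad_x F xbar wbar) v = 0 \<or> \<gamma> \<ge> 0 \<and> inner (grad_x F xbar wbar) v \<ge> 0"
    using normal_cone_complementarity[OF q(1)] by (auto simp: qv)
  then show "w' \<in> Gamma3 f0 F xbar wbar x'"
    unfolding Gamma3_def using 1 2 by force
qed

theorem mainTheorem6:
  fixes f0 F :: "(real^'n) \<times> (real^'d) \<Rightarrow> real"
    and xbar :: "real^'n" and wbar :: "real^'d"
  assumes "C2 f0" and "C2 F"
    and "xbar \<in> solution_map f0 F wbar"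
    and "F (xbar, wbar) = 0"
    and "grad_x F xbar wbar \<noteq> 0"
    and "{l::real. l \<ge> 0 \<and> grad_x f0 xbar wbar + l *\<^sub>R grad_x F xbar wbar = 0} = {0}"
  shows "(\<forall>x'. Gamma1_hat f0 F xbar wbar x' \<subseteq> frechet_coderivative (solution_map f0 F) wbar xbar x' \<and>
               frechet_coderivative (solution_map f0 F) wbar xbar x'
                 \<subseteq> coderivative (solution_map f0 F) wbar xbar x') \<and>
         (ker (A1' f0 F xbar wbar) \<inter> ker (A2' f0 F xbar wbar) = {0} \<longrightarrow>
          (\<forall>x'. coderivative (solution_map f0 F) wbar xbar x' \<subseteq> Gamma3 f0 F xbar wbar x'))"
proof -
  \<comment> \<open>That 0 is an admissible multiplier says that \<open>grad_x f0\<close> vanishes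
    at the reference point.\<close>
  have "0 \<in> {l::real. l \<ge> 0 \<and> grad_x f0 xbar wbar + l *\<^sub>R grad_x F xbar wbar = 0}"
    unfolding assms(6) by simp
  then have G0: "grad_x f0 xbar wbar = 0" by simp
  have "frechet_coderivative (solution_map f0 F) wbar xbar x' \<subseteq> coderivative (solution_map f0 F) wbar xbar x'" for x'
    unfolding frechet_coderivative_def coderivative_def
    using frechet_normal_subset_normal by blast
  then show ?thesis
    using Gamma1_hat_subset_frechet_coderivative[OF assms(1-5) G0]
      coderivative_subset_Gamma3[OF assms(1,2,4,5) G0] by blast
qed

end
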